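(* There exists a fully looped undirected $\aleph_0$-regular acyclic Borel graph $G$ on a Polish space $(X,\tau)$ of vertices such that $G$ admits no $\tau$-Baire measurable domatic $3$-partition.
   Context: A Borel graph on $X$ is a Borel subset $G\subseteq X^2$ (edges, loops allowed); it is undirected if $G$ is symmetric, and fully looped if $(x,x)\in G$ for every $x\in X$. The neighborhood of $x$ is $N_G(x)=\{y\in X:(x,y)\in G\}$ (so $x\in N_G(x)$ when $G$ is fully looped). $G$ is $\aleph_0$-regular if $|N_G(x)|=\aleph_0$ for every $x\in X$. An undirected graph with loops is acyclic if the graph obtained by deleting all loops is acyclic (a forest). A $\tau$-Baire measurable domatic $3$-partition is a triple of pairwise-disjoint subsets $D_0,D_1,D_2$ of $X$, each with the Baire property with respect to $\tau$, such that $D_j\cap N_G(x)\neq\varnothing$ for every $x\in X$ and $j<3$. *)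

theory Defs
  imports "HOL-Analysis.Analysis"
begin

section \<open>Polish topologies, Borel sets and the Baire property\<close>

definition Polish_topology :: "'a topology \<Rightarrow> bool" where
  "Polish_topology X \<longleftrightarrow> completely_metrizable_space X \<and> separable_space X"

definition borel_sets_of :: "'a topology \<Rightarrow> 'a set set" where
  "borel_sets_of X = sigma_sets (topspace X) {U. openin X U}"

definition nowhere_dense_in :: "'a topology \<Rightarrow> 'a set \<Rightarrow> bool" where
  "nowhere_dense_in X A \<longleftrightarrow> A \<subseteq> topspace X \<and> X interior_of (X closure_of A) = {}"

definition meager_in :: "'a topology \<Rightarrow> 'a set \<Rightarrow> bool" where
  "meager_in X A \<longleftrightarrow> (\<exists>N :: nat \<Rightarrow> 'a set. (\<forall>n. nowhere_dense_in X (N n)) \<and> A = (\<Union>n. N n))"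

definition Baire_property :: "'a topology \<Rightarrow> 'a set \<Rightarrow> bool" where
  "Baire_property X A \<longleftrightarrow>
     A \<subseteq> topspace X \<and> (\<exists>U. openin X U \<and> meager_in X ((A - U) \<union> (U - A)))"

section \<open>Borel graphs\<close>

definition Borel_graph :: "'a topology \<Rightarrow> ('a \<times> 'a) set \<Rightarrow> bool" where
  "Borel_graph X G \<longleftrightarrow> G \<in> borel_sets_of (prod_topology X X)"

definition fully_looped :: "'a topology \<Rightarrow> ('a \<times> 'a) set \<Rightarrow> bool" where
  "fully_looped X G \<longleftrightarrow> (\<forall>x \<in> topspace X. (x, x) \<in> G)"

definition neighborhood :: "('a \<times> 'a) set \<Rightarrow> 'a \<Rightarrow> 'a set" where
  "neighborhood G x = {y. (x, y) \<in> G}"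

definition aleph0_regular :: "'a topology \<Rightarrow> ('a \<times> 'a) set \<Rightarrow> bool" where
  "aleph0_regular X G \<longleftrightarrow> (\<forall>x \<in> topspace X. neighborhood G x \<approx> (UNIV :: nat set))"

definition graph_cycle :: "('a \<times> 'a) set \<Rightarrow> 'a list \<Rightarrow> bool" where
  "graph_cycle E xs \<longleftrightarrow> length xs \<ge> 3 \<and> distinct xs \<and>
     (\<forall>i < length xs. (xs ! i, xs ! (Suc i mod length xs)) \<in> E)"

text \<open>The library's \<^const>\<open>acyclic\<close> speaks about directed cycles and fails for every
  nonempty symmetric relation, so it is not the notion needed here.\<close>

definition acyclic_graph :: "('a \<times> 'a) set \<Rightarrow> bool" where
  "acyclic_graph G \<longleftrightarrow> \<not> (\<exists>xs. graph_cycle (G - Id) xs)"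

text \<open>The parts need not cover the vertex set.\<close>

definition Baire_domatic_partition ::
    "'a topology \<Rightarrow> ('a \<times> 'a) set \<Rightarrow> nat \<Rightarrow> (nat \<Rightarrow> 'a set) \<Rightarrow> bool" where
  "Baire_domatic_partition X G k D \<longleftrightarrow>
     disjoint_family_on D {..<k} \<and>
     (\<forall>j < k. Baire_property X (D j)) \<and>
     (\<forall>x \<in> topspace X. \<forall>j < k. D j \<inter> neighborhood G x \<noteq> {})"

lemma Borel_graph_subset:
  assumes "Borel_graph X G"
  shows "G \<subseteq> topspace X \<times> topspace X"
proof -
  have "{U. openin (prod_topology X X) U} \<subseteq> Pow (topspace (prod_topology X X))"
    using openin_subset by blast
  from sigma_sets_into_sp[OF this] show ?thesis
    using assms unfolding Borel_graph_def borel_sets_of_def topspace_prod_topology by blast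
qed

section \<open>A type that carries all Polish spaces\<close>

text \<open>HOL cannot quantify existentially over types.  The following lemma shows that nothing is
  lost by letting an existentially quantified Polish space be a topology whose underlying set
  is some subset of \<^typ>\<open>nat \<Rightarrow> nat\<close>; that topology is unrelated to the
  product topology on \<^typ>\<open>nat \<Rightarrow> nat\<close>.\<close>

lemma Polish_topology_homeomorphic_copy:
  fixes X :: "'a topology"
  assumes "Polish_topology X"
  shows "\<exists>Y :: (nat \<Rightarrow> nat) topology. X homeomorphic_space Y"
proof -
  obtain M d where "Metric_space M d" and X: "X = Metric_space.mtopology M d"
    using assms unfolding Polish_topology_def completely_metrizable_space_def by blast
  then interpret Metric_space M d by simp
  obtain C where C: "countable C" "C \<subseteq> M" "mtopology closure_of C = M"
    using assms by (auto simp: Polish_topology_def separable_space_def X)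
  define \<B> where "\<B> = (\<lambda>(c, k). mball c (inverse (real (Suc k)))) ` (C \<times> UNIV)"
  have count: "countable \<B>"
    unfolding \<B>_def using C(1) by (intro countable_image countable_SIGMA) auto
  have sep: "\<exists>V \<in> \<B>. x \<in> V \<and> y \<notin> V" if "x \<in> M" "y \<in> M" "x \<noteq> y" for x y
  proof -
    have "0 < d x y / 2"
      using that by simp
    then obtain k where k: "inverse (real (Suc k)) < d x y / 2"
      using reals_Archimedean by blast
    have "x \<in> mtopology closure_of C"
      using C(3) that(1) by blast
    moreover have "inverse (real (Suc k)) > 0"
      by simp
    ultimately obtain c where c: "c \<in> C" "c \<in> mball x (inverse (real (Suc k)))"
      unfolding metric_closure_of by blast
    then have "x \<in> mball c (inverse (real (Suc k)))"
      by (simp add: in_mball commute)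
    moreover have "y \<notin> mball c (inverse (real (Suc k)))"
      using c k triangle[of x c y] that by (simp add: in_mball)
    ultimately show ?thesis
      using c(1) unfolding \<B>_def by blast
  qed
  define B where "B = from_nat_into (insert {} \<B>)"
  have rB: "range B = insert {} \<B>"
    unfolding B_def by (rule range_from_nat_into) (use count in auto)
  define f :: "'a \<Rightarrow> nat \<Rightarrow> nat" where "f x n = (if x \<in> B n then 1 else 0)" for x n
  have inj: "inj_on f (topspace X)"
  proof (rule inj_onI, rule ccontr)
    fix x y assume xy: "x \<in> topspace X" "y \<in> topspace X" "f x = f y" "x \<noteq> y"
    then obtain V where V: "V \<in> \<B>" "x \<in> V" "y \<notin> V"
      using sep X topspace_mtopology by metis
    then obtain n where "V = B n"
      using rB by (metis insertCI rangeE)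
    with V fun_cong[OF xy(3), of n] show False
      by (simp add: f_def)
  qed
  define g where "g = inv_into (topspace X) f"
  define Y where "Y = pullback_topology (f ` topspace X) g X"
  have gf: "g (f x) = x" if "x \<in> topspace X" for x
    using inj that by (simp add: g_def)
  have "continuous_map X Y f"
    unfolding Y_def
  proof (rule continuous_map_pullback')
    show "continuous_map X X (g \<circ> f)"
      by (rule continuous_map_eq[OF continuous_map_id]) (simp add: gf)
    show "topspace X \<subseteq> f -` f ` topspace X"
      by auto
  qed
  moreover have "continuous_map Y X g"
    using continuous_map_pullback[OF continuous_map_id, of "f ` topspace X" g X]
    by (simp add: Y_def)
  moreover have "\<forall>y \<in> topspace Y. f (g y) = y"
    by (auto simp: Y_def topspace_pullback_topology gf)
  ultimately show ?thesis
    unfolding homeomorphic_space_def homeomorphic_maps_def using gf by blast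
qed

end

theory Submission
  imports Defs "HOL-Library.Nat_Bijection"
begin

text \<open>
  Let a countable free product of copies of \<open>\<int>/2\<close> with generators \<open>a\<^sub>i\<^sub>,\<^sub>k\<close> act freely on a countable set
  \<open>T\<close>, and let \<open>W\<close> be the Baire space \<open>T\<^sup>\<nat>\<close>.  The homeomorphism \<open>h\<^sub>i\<^sub>,\<^sub>k\<close> of \<open>W\<close> applies \<open>a\<^sub>i\<^sub>,\<^sub>k\<close> to all
  coordinates except the first \<open>k\<close>.  The vertices are \<open>W\<close> together with countably many copies
  \<open>Z\<^sub>k\<close> of \<open>W\<close>, and \<open>z \<in> Z\<^sub>k\<close> is joined to \<open>h\<^sub>i\<^sub>,\<^sub>k z \<in> W\<close> for all \<open>i\<close>.
  A cycle uses only finitely many \<open>k\<close>, so it projects to a sufficiently late coordinate without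
  backtracking, which is impossible in a tree.
  By the Baire property, some nonempty open \<open>U \<subseteq> W\<close> generically meets at most one of the three
  sets \<open>D\<^sub>j\<close>.  For large \<open>k\<close> the elements of an open subset of \<open>Z\<^sub>k\<close> have all their other neighbors in
  \<open>U\<close>, and generically outside the exceptional meager set.  Such a vertex would have to lie itself
  in the two remaining sets.
\<close>

section \<open>A free action on lists\<close>

text \<open>Looking at the parity of the leading block of \<open>j\<close>s, instead of at the head only, makes \<open>toggle j\<close>
  an involution on all lists, not just on reduced words.\<close>

definition toggle :: "'a \<Rightarrow> 'a list \<Rightarrow> 'a list" where
  "toggle j l = (if odd (length (takeWhile ((=) j) l)) then tl l else j # l)"

lemma toggle_toggle [simp]: "toggle j (toggle j l) = l"
  by (cases l) (auto simp: toggle_def)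

text \<open>Only \<open>j = hd l\<close> can shorten \<open>l\<close>, so every list has at most one
  shorter neighbor. This forest structure is what excludes cycles.\<close>

lemma length_toggle:
  "length (toggle j l) = Suc (length l) \<or> (Suc (length (toggle j l)) = length l \<and> j = hd l)"
  by (cases l) (auto simp: toggle_def)

lemma toggle_eq_iff [simp]: "toggle i l = toggle j l \<longleftrightarrow> i = j"
  by (cases l) (auto simp: toggle_def dest: arg_cong[where f = length])

definition toggle_code :: "nat \<Rightarrow> nat \<Rightarrow> nat" where
  "toggle_code j m = list_encode (toggle j (list_decode m))"

lemma toggle_code_toggle_code [simp]: "toggle_code j (toggle_code j m) = m"
  by (simp add: toggle_code_def)

lemma toggle_code_eq_iff [simp]: "toggle_code i m = toggle_code j m \<longleftrightarrow> i = j"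
  by (simp add: toggle_code_def list_encode_eq)

section \<open>The graph\<close>

text \<open>Coordinate 0 of a vertex \<open>f\<close> is its type: 0 for elements of \<open>W\<close> and \<open>Suc k\<close> for elements of
  \<open>Z\<^sub>k\<close>.  Exchanging the types 0 and \<open>Suc k\<close> makes \<open>flip i k\<close> an involution of the whole space.\<close>

definition flip :: "nat \<Rightarrow> nat \<Rightarrow> (nat \<Rightarrow> nat) \<Rightarrow> nat \<Rightarrow> nat" where
  "flip i k f n =
     (if n = 0 then (if f 0 = 0 then Suc k else if f 0 = Suc k then 0 else f 0)
      else if n \<le> k then f n else toggle_code (prod_encode (i, k)) (f n))"

text \<open>The condition on \<open>f 0\<close> keeps only the flips that exchange two types; for
  any other \<open>f\<close>, \<open>flip i k\<close> would add an edge inside a single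
  copy.\<close>

definition flip_graph :: "((nat \<Rightarrow> nat) \<times> (nat \<Rightarrow> nat)) set" where
  "flip_graph = Id \<union> {(f, flip i k f) | f i k. f 0 = 0 \<or> f 0 = Suc k}"

lemma flip_flip [simp]: "flip i k (flip i k f) = f"
  by (rule ext) (auto simp: flip_def)

lemma flip_0 [simp]: "flip i k f 0 = (if f 0 = 0 then Suc k else if f 0 = Suc k then 0 else f 0)"
  by (simp add: flip_def)

lemma in_flip_graph_iff:
  "(f, g) \<in> flip_graph \<longleftrightarrow> f = g \<or> (\<exists>i k. g = flip i k f \<and> (f 0 = 0 \<or> f 0 = Suc k))"
  by (auto simp: flip_graph_def)

lemma sym_flip_graph: "sym flip_graph"
proof (rule symI)
  fix f g assume "(f, g) \<in> flip_graph"
  then consider "f = g" | i k where "g = flip i k f" "f 0 = 0 \<or> f 0 = Suc k"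
    by (auto simp: flip_graph_def)
  then show "(g, f) \<in> flip_graph"
  proof cases
    case (2 i k)
    then have "f = flip i k g" "g 0 = 0 \<or> g 0 = Suc k"
      by auto
    then show ?thesis
      unfolding flip_graph_def by blast
  qed (simp add: flip_graph_def)
qed

lemma neighborhood_flip_graph_0:
  "f 0 = 0 \<Longrightarrow> neighborhood flip_graph f = insert f (range (\<lambda>(i, k). flip i k f))"
  by (auto simp: neighborhood_def flip_graph_def)

lemma neighborhood_flip_graph_Suc:
  "f 0 = Suc k \<Longrightarrow> neighborhood flip_graph f = insert f (range (\<lambda>i. flip i k f))"
  by (auto simp: neighborhood_def flip_graph_def)

section \<open>Degrees and Borel complexity of the graph\<close>

lemma aleph0_regular_flip_graph: "aleph0_regular X flip_graph"
  unfolding aleph0_regular_def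
proof
  fix f :: "nat \<Rightarrow> nat"
  have "countable (neighborhood flip_graph f) \<and> infinite (neighborhood flip_graph f)"
  proof (cases "f 0")
    case 0
    have "inj (\<lambda>k. flip 0 k f)"
      by (rule injI) (drule fun_cong[where x = 0], simp add: 0)
    then have "infinite (range (\<lambda>k. flip 0 k f))"
      by (simp add: finite_image_iff)
    moreover have "range (\<lambda>k. flip 0 k f) \<subseteq> neighborhood flip_graph f"
      by (auto simp: neighborhood_flip_graph_0 0)
    ultimately show ?thesis
      using 0 by (auto simp: neighborhood_flip_graph_0 dest: finite_subset)
  next
    case (Suc k)
    \<comment> \<open>These neighbors all have type 0; they are told apart at coordinate
      \<open>Suc k\<close>, the first one on which the generators act.\<close>
    have "inj (\<lambda>i. flip i k f)"
      by (rule injI) (drule fun_cong[where x = "Suc k"], simp add: flip_def)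
    then show ?thesis
      using Suc by (simp add: neighborhood_flip_graph_Suc finite_image_iff)
  qed
  then show "neighborhood flip_graph f \<approx> (UNIV :: nat set)"
    by (metis countableE_infinite eqpoll_def)
qed

lemma continuous_on_flip: "continuous_on UNIV (flip i k)"
proof (rule continuous_on_coordinatewise_then_product)
  fix n
  have disc: "continuous_on UNIV (\<lambda>f. c (f m))" for c :: "nat \<Rightarrow> nat" and m :: nat
    by (rule continuous_on_compose2[of UNIV c]) (auto simp: continuous_on_discrete)
  consider "n = 0" | "0 < n" "n \<le> k" | "k < n"
    by linarith
  then show "continuous_on UNIV (\<lambda>f. flip i k f n)"
    by cases (auto simp: flip_def intro: disc)
qed

lemma homeomorphic_map_flip: "homeomorphic_map euclidean euclidean (flip i k)"
  by (rule homeomorphic_maps_imp_map[where g = "flip i k"])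
    (simp add: homeomorphic_maps_def continuous_on_flip)

text \<open>A countable union of closed sets: the diagonal and the graphs of the continuous maps
  \<open>flip i k\<close>, each restricted to a closed set of types.\<close>

lemma Borel_graph_flip_graph: "Borel_graph euclidean flip_graph"
proof -
  let ?S = "sigma_sets UNIV {U :: ((nat \<Rightarrow> nat) \<times> (nat \<Rightarrow> nat)) set. open U}"
  have closed: "A \<in> ?S" if "closed A" for A
    using sigma_sets.Compl[of "-A" UNIV "{U. open U}"] that
    by (auto simp: closed_def Compl_eq_Diff_UNIV[symmetric])
  have snd: "continuous_on UNIV (\<lambda>p :: (nat \<Rightarrow> nat) \<times> (nat \<Rightarrow> nat). snd p n)" for n
    by (rule continuous_on_product_then_coordinatewise, rule continuous_on_snd, rule continuous_on_id)
  have fst: "continuous_on UNIV (\<lambda>p :: (nat \<Rightarrow> nat) \<times> (nat \<Rightarrow> nat). c (fst p) n)"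
    if "continuous_on UNIV c" for c :: "(nat \<Rightarrow> nat) \<Rightarrow> nat \<Rightarrow> nat" and n
    by (rule continuous_on_product_then_coordinatewise, rule continuous_on_compose2[OF that],
        rule continuous_on_fst, rule continuous_on_id) simp
  have graph: "closed {p. \<forall>n. snd p n = c (fst p) n}"
    if "continuous_on UNIV c" for c :: "(nat \<Rightarrow> nat) \<Rightarrow> nat \<Rightarrow> nat"
    by (intro closed_Collect_all closed_Collect_eq snd fst[OF that])
  define E :: "nat \<Rightarrow> nat \<Rightarrow> ((nat \<Rightarrow> nat) \<times> (nat \<Rightarrow> nat)) set" where
    "E i k = {p. \<forall>n. snd p n = flip i k (fst p) n} \<inter> ({p. fst p 0 = 0} \<union> {p. fst p 0 = Suc k})" for i k
  have E: "closed (E i k)" for i k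
    unfolding E_def
    by (intro closed_Int closed_Un graph continuous_on_flip closed_Collect_eq fst continuous_on_id
        continuous_on_const)
  have "flip_graph = {p. \<forall>n. snd p n = fst p n} \<union> (\<Union>q. E (fst q) (snd q))"
  proof (rule set_eqI)
    fix p :: "(nat \<Rightarrow> nat) \<times> (nat \<Rightarrow> nat)"
    obtain f g where "p = (f, g)"
      by (cases p)
    then show "p \<in> flip_graph \<longleftrightarrow> p \<in> {p. \<forall>n. snd p n = fst p n} \<union> (\<Union>q. E (fst q) (snd q))"
      unfolding E_def by (simp add: in_flip_graph_iff eq_commute[of f g] flip: fun_eq_iff)
  qed
  also have "\<dots> \<in> ?S"
  proof (rule sigma_sets_Un)
    show "{p. \<forall>n. snd p n = fst p n} \<in> ?S"
      by (rule closed[OF graph[OF continuous_on_id]])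
    show "(\<Union>q. E (fst q) (snd q)) \<in> ?S"
      by (rule sigma_sets_UNION) (auto intro: closed[OF E])
  qed
  finally show ?thesis
    by (simp add: Borel_graph_def borel_sets_of_def)
qed

section \<open>Acyclicity\<close>

lemma acyclic_flip_graph: "acyclic_graph flip_graph"
  unfolding acyclic_graph_def
proof
  assume "\<exists>xs. graph_cycle (flip_graph - Id) xs"
  then obtain xs where xs: "3 \<le> length xs" "distinct xs"
    and edge: "\<And>i. i < length xs \<Longrightarrow> (xs ! i, xs ! (Suc i mod length xs)) \<in> flip_graph - Id"
    unfolding graph_cycle_def by blast
  let ?n = "length xs"
  obtain N where N: "\<And>f. f \<in> set xs \<Longrightarrow> f 0 \<le> N"
    using finite_nat_set_iff_bounded_le[of "(\<lambda>f. f 0) ` set xs"] by auto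
  \<comment> \<open>Every edge of the cycle uses some \<open>k\<close> with
    \<open>Suc k \<le> N\<close>, so each acts on coordinate \<open>N'\<close> by a toggle.\<close>
  define N' where "N' = Suc N"
  define height where "height f = length (list_decode (f N'))" for f :: "nat \<Rightarrow> nat"
  \<comment> \<open>The head of the list names the only generator that can shorten it. If the list
    is empty, the value is arbitrary, but then no neighbor on the cycle is lower.\<close>
  define down where
    "down f = (let (i, k) = prod_decode (hd (list_decode (f N'))) in flip i k f)" for f
  have step: "height g < height f \<and> g = down f"
    if fg: "(f, g) \<in> flip_graph - Id" "f \<in> set xs" "g \<in> set xs" "height g \<le> height f" for f g
  proof -
    obtain i k where ik: "g = flip i k f" "f 0 = 0 \<or> f 0 = Suc k"
      using fg(1) by (auto simp: in_flip_graph_iff)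
    then have "k < N'"
      using N[OF fg(2)] N[OF fg(3)] by (auto simp: N'_def)
    then have "list_decode (g N') = toggle (prod_encode (i, k)) (list_decode (f N'))"
      by (simp add: ik flip_def toggle_code_def)
    with length_toggle[of "prod_encode (i, k)" "list_decode (f N')"] fg(4)
    have "Suc (height g) = height f" "hd (list_decode (f N')) = prod_encode (i, k)"
      by (auto simp: height_def)
    then show ?thesis
      by (simp add: down_def ik)
  qed
  \<comment> \<open>At a highest vertex both cycle neighbors are no higher, hence both equal its
    \<open>down\<close>.\<close>
  obtain m where m: "m < ?n" and max: "\<And>f. f \<in> set xs \<Longrightarrow> height f \<le> height (xs ! m)"
  proof -
    have "set xs \<noteq> {}"
      using xs(1) by auto
    then have "Max (height ` set xs) \<in> height ` set xs"
      by (intro Max_in) auto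
    then obtain f where "f \<in> set xs" "height f = Max (height ` set xs)"
      by auto
    then show ?thesis
      using that by (metis List.finite_set Max_ge finite_imageI imageI in_set_conv_nth)
  qed
  define s where "s = Suc m mod ?n"
  define p where "p = (if m = 0 then ?n - 1 else m - 1)"
  \<comment> \<open>Successor and predecessor differ because the cycle has at least three
    vertices.\<close>
  have sp: "s < ?n" "p < ?n" "s \<noteq> p" "Suc p mod ?n = m"
    using m xs(1) by (auto simp: s_def p_def mod_Suc)
  have "xs ! s = down (xs ! m)"
    using step[of "xs ! m" "xs ! s"] edge[OF m] max m sp by (simp add: s_def)
  moreover have "xs ! p = down (xs ! m)"
  proof -
    have "(xs ! m, xs ! p) \<in> flip_graph - Id"
      using edge[OF sp(2)] sym_flip_graph sp(4) by (auto dest: symD)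
    then show ?thesis
      using step[of "xs ! m" "xs ! p"] max m sp by simp
  qed
  ultimately show False
    using sp xs(2) by (metis nth_eq_iff_index_eq)
qed

section \<open>Baire category\<close>

text \<open>Homeomorphisms pull nowhere dense sets back to nowhere dense sets, so countably many
  such conditions can be avoided at one point.\<close>

lemma Baire_avoid_meager:
  fixes h :: "nat \<Rightarrow> 'a \<Rightarrow> 'a"
  assumes X: "completely_metrizable_space X"
    and h: "\<And>i. homeomorphic_map X X (h i)"
    and J: "countable J" "\<And>j. j \<in> J \<Longrightarrow> meager_in X (M j)"
    and V: "openin X V" "V \<noteq> {}"
  shows "\<exists>x \<in> V. \<forall>i. \<forall>j \<in> J. h i x \<notin> M j"
proof -
  have "\<forall>j \<in> J. \<exists>N. (\<forall>n. nowhere_dense_in X (N n)) \<and> M j = (\<Union>n :: nat. N n)"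
    using J(2) unfolding meager_in_def by blast
  from bchoice[OF this] obtain N where
    "\<forall>j \<in> J. (\<forall>n. nowhere_dense_in X (N j n)) \<and> M j = (\<Union>n :: nat. N j n)" ..
  then have N: "\<And>j n. j \<in> J \<Longrightarrow> nowhere_dense_in X (N j n)" "\<And>j. j \<in> J \<Longrightarrow> M j = (\<Union>n. N j n)"
    by blast+
  \<comment> \<open>Taking closures first makes these preimages closed, as the category theorem
    requires.\<close>
  define T where "T i j n = {x \<in> topspace X. h i x \<in> X closure_of (N j n)}" for i j and n :: nat
  define \<G> where "\<G> = (\<lambda>(i, j, n). T i j n) ` (UNIV \<times> J \<times> UNIV)"
  have "X interior_of \<Union>\<G> = {}"
  proof (rule Baire_category_alt)
    show "countable \<G>"
      unfolding \<G>_def using J(1) by (intro countable_image countable_SIGMA) auto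
    fix A assume "A \<in> \<G>"
    then obtain i j n where A: "A = T i j n" and j: "j \<in> J"
      by (auto simp: \<G>_def)
    have "closedin X A"
      unfolding A T_def
      by (rule closedin_continuous_map_preimage[OF homeomorphic_imp_continuous_map[OF h]]) simp
    moreover have "X interior_of A = {}"
    proof -
      let ?U = "X interior_of A"
      have "openin X (h i ` ?U)"
        using homeomorphic_imp_open_map[OF h] by (simp add: open_map_def)
      moreover have "h i ` ?U \<subseteq> X closure_of (N j n)"
        using interior_of_subset[of X A] by (auto simp: A T_def)
      ultimately have "h i ` ?U \<subseteq> X interior_of (X closure_of (N j n))"
        by (simp add: interior_of_maximal)
      then show ?thesis
        using N(1)[OF j] by (simp add: nowhere_dense_in_def)
    qed
    ultimately show "closedin X A \<and> X interior_of A = {}" ..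
  qed (use X in simp)
  then have "\<not> V \<subseteq> \<Union>\<G>"
    using V interior_of_maximal[of V "\<Union>\<G>" X] by auto
  then obtain x where x: "x \<in> V" "x \<notin> \<Union>\<G>"
    by blast
  have "h i x \<notin> M j" if j: "j \<in> J" for i j
  proof
    assume "h i x \<in> M j"
    then obtain n where n: "h i x \<in> N j n"
      using N(2)[OF j] by blast
    moreover have "N j n \<subseteq> X closure_of (N j n)"
      using N(1)[OF j] by (simp add: nowhere_dense_in_def closure_of_subset)
    moreover have "x \<in> topspace X"
      using openin_subset[OF V(1)] x(1) by blast
    ultimately have "x \<in> T i j n"
      by (auto simp: T_def)
    then show False
      using x(2) j by (auto simp: \<G>_def)
  qed
  then show ?thesis
    using x(1) by blast
qed

section \<open>Topology of the Baire space\<close>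

lemma Polish_topology_Baire_space: "Polish_topology (euclidean :: (nat \<Rightarrow> nat) topology)"
proof -
  have "(euclidean :: nat topology) = discrete_topology UNIV"
    by (simp add: topology_eq open_discrete)
  then have "completely_metrizable_space (product_topology (\<lambda>_ :: nat. euclidean :: nat topology) UNIV)"
    by (simp add: completely_metrizable_space_product_topology completely_metrizable_space_discrete_topology)
  moreover obtain C :: "(nat \<Rightarrow> nat) set" where
    C: "countable C" "\<And>U. open U \<Longrightarrow> U \<noteq> {} \<Longrightarrow> \<exists>c \<in> C. c \<in> U"
    using countable_dense_exists by blast
  have "closure C = UNIV"
    using C(2)[of "- closure C"] closure_subset[of C] by auto
  then have "separable_space (euclidean :: (nat \<Rightarrow> nat) topology)"
    using C(1) by (auto simp: separable_space_def)
  ultimately show ?thesis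
    by (simp add: Polish_topology_def euclidean_product_topology)
qed

lemma open_cylinder: "open {f :: nat \<Rightarrow> nat. \<forall>n \<le> K. f n = g n}"
  using product_topology_basis'[of "{..K}" "\<lambda>n. {g n}" "\<lambda>n. n"] by (simp add: open_discrete Ball_def)

lemma cylinder_subset_open:
  fixes U :: "(nat \<Rightarrow> nat) set"
  assumes "open U" "u \<in> U"
  obtains K where "{f. \<forall>n \<le> K. f n = u n} \<subseteq> U"
proof -
  obtain Y where Y: "u \<in> Pi\<^sub>E UNIV Y" "finite {n. Y n \<noteq> UNIV}" "Pi\<^sub>E UNIV Y \<subseteq> U"
    using product_topology_open_contains_basis[of "\<lambda>_. euclidean" UNIV U u] assms
    by (auto simp: open_fun_def)
  then obtain K where K: "\<And>n. Y n \<noteq> UNIV \<Longrightarrow> n \<le> K"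
    using finite_nat_set_iff_bounded_le by auto
  have "f n \<in> Y n" if "\<forall>n \<le> K. f n = u n" for f n
    using Y(1) K[of n] that by (cases "Y n = UNIV") (auto simp: PiE_iff)
  then have "{f. \<forall>n \<le> K. f n = u n} \<subseteq> U"
    using Y(3) by (auto simp: PiE_iff)
  then show ?thesis ..
qed

section \<open>Nonexistence of the partition\<close>

lemma no_Baire_domatic_partition_flip_graph: "\<not> Baire_domatic_partition euclidean flip_graph 3 D"
proof
  assume D: "Baire_domatic_partition euclidean flip_graph 3 D"
  then have disj: "\<And>i j. i < 3 \<Longrightarrow> j < 3 \<Longrightarrow> i \<noteq> j \<Longrightarrow> D i \<inter> D j = {}"
    and dom: "\<And>j f. j < 3 \<Longrightarrow> D j \<inter> neighborhood flip_graph f \<noteq> {}"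
    by (auto simp: Baire_domatic_partition_def disjoint_family_on_def)
  have "\<forall>j < 3. \<exists>U. open U \<and> meager_in euclidean ((D j - U) \<union> (U - D j))"
    using D by (auto simp: Baire_domatic_partition_def Baire_property_def)
  then obtain B where B: "\<And>j. j < 3 \<Longrightarrow> open (B j)"
    and meager: "\<And>j. j < 3 \<Longrightarrow> meager_in euclidean ((D j - B j) \<union> (B j - D j))"
    by metis
  \<comment> \<open>Outside all \<open>M l\<close>, membership in \<open>D j\<close> and in the open
    set \<open>B j\<close> agree.\<close>
  define M where "M j = (D j - B j) \<union> (B j - D j)" for j
  define W where "W = {f :: nat \<Rightarrow> nat. f 0 = 0}"
  have W: "open W"
    using open_cylinder[of 0 "\<lambda>_. 0"] by (simp add: W_def)
  have "(\<lambda>_. 0) \<in> W"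
    by (simp add: W_def)
  have "\<exists>U j0. open U \<and> U \<noteq> {} \<and> U \<subseteq> W \<and>
      (\<forall>u \<in> U. \<forall>j < 3. (\<forall>l < 3. u \<notin> M l) \<longrightarrow> u \<in> D j \<longrightarrow> j = j0)"
  proof (cases "\<exists>j0 < 3. B j0 \<inter> W \<noteq> {}")
    case True
    then obtain j0 where "j0 < 3" "B j0 \<inter> W \<noteq> {}"
      by blast
    moreover have "j = j0" if "u \<in> B j0" "j < 3" "\<forall>l < 3. u \<notin> M l" "u \<in> D j" for u j
    proof -
      have "u \<in> D j0"
        using that \<open>j0 < 3\<close> by (auto simp: M_def)
      then show ?thesis
        using disj[OF that(2) \<open>j0 < 3\<close>] that(4) by blast
    qed
    ultimately show ?thesis
      using B W by (intro exI[of _ "B j0 \<inter> W"] exI[of _ j0]) (auto simp: open_Int)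
  next
    case False
    \<comment> \<open>No \<open>B j\<close> meets \<open>W\<close>, so points of \<open>W\<close>
      outside all \<open>M l\<close> lie in no \<open>D j\<close>; the choice \<open>j0 = 0\<close>
      is arbitrary.\<close>
    then have "u \<in> M j" if "u \<in> W" "j < 3" "u \<in> D j" for u j
      using that by (auto simp: M_def)
    then have "\<forall>u \<in> W. \<forall>j < 3. (\<forall>l < 3. u \<notin> M l) \<longrightarrow> u \<in> D j \<longrightarrow> j = 0"
      by blast
    then show ?thesis
      using W \<open>(\<lambda>_. 0) \<in> W\<close> by blast
  qed
  then obtain U j0 where U: "open U" "U \<noteq> {}" "U \<subseteq> W"
    and j0: "\<And>u j. u \<in> U \<Longrightarrow> j < 3 \<Longrightarrow> (\<forall>l < 3. u \<notin> M l) \<Longrightarrow> u \<in> D j \<Longrightarrow> j = j0"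
    by blast
  obtain u where u: "u \<in> U"
    using U(2) by blast
  then have "u 0 = 0"
    using U(3) by (auto simp: W_def)
  obtain K where K: "{f. \<forall>n \<le> K. f n = u n} \<subseteq> U"
    using cylinder_subset_open[OF U(1) u] .
  \<comment> \<open>\<open>K\<close> serves twice, as cylinder length and as index of the copy:
    \<open>flip i K\<close> resets the type to \<open>u 0\<close> and fixes coordinates 1 to
    \<open>K\<close>, so it maps \<open>V\<close> into \<open>U\<close> for every
    \<open>i\<close>.\<close>
  define V where "V = {f. \<forall>n \<le> K. f n = (u(0 := Suc K)) n}"
  have "u(0 := Suc K) \<in> V"
    by (simp add: V_def)
  have "\<exists>f \<in> V. \<forall>i. \<forall>l \<in> {..<3}. flip i K f \<notin> M l"
  proof (rule Baire_avoid_meager[where X = euclidean])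
    show "completely_metrizable_space (euclidean :: (nat \<Rightarrow> nat) topology)"
      using Polish_topology_Baire_space by (simp add: Polish_topology_def)
    show "homeomorphic_map euclidean euclidean (flip i K)" for i
      by (rule homeomorphic_map_flip)
    show "meager_in euclidean (M l)" if "l \<in> {..<3}" for l
      using meager that by (simp add: M_def)
    show "openin euclidean V"
      unfolding V_def using open_cylinder by simp
    show "V \<noteq> {}"
      using \<open>u(0 := Suc K) \<in> V\<close> by blast
  qed simp
  then obtain f where f: "f \<in> V" and gen: "\<And>i l. l < 3 \<Longrightarrow> flip i K f \<notin> M l"
    by blast
  have "flip i K f \<in> U" for i
    using K f \<open>u 0 = 0\<close> by (auto simp: V_def flip_def)
  with gen j0 have "flip i K f \<notin> D j" if "j < 3" "j \<noteq> j0" for i j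
    using that by blast
  moreover have "f 0 = Suc K"
    using f by (auto simp: V_def)
  \<comment> \<open>No neighbor \<open>flip i K f\<close> lies in \<open>D j\<close>, so only the
    loop at \<open>f\<close> can meet it.\<close>
  ultimately have in_D: "f \<in> D j" if "j < 3" "j \<noteq> j0" for j
    using dom[OF that(1), of f] that by (auto simp: neighborhood_flip_graph_Suc)
  obtain a b :: nat where "a < 3" "b < 3" "a \<noteq> j0" "b \<noteq> j0" "a \<noteq> b"
  proof -
    have "j0 = 0 \<or> j0 = 1 \<or> (j0 \<noteq> 0 \<and> j0 \<noteq> 1)"
      by blast
    then show ?thesis
      using that[of 1 2] that[of 0 2] that[of 0 1] by auto
  qed
  then show False
    using in_D disj by blast
qed

theorem theorem1p7:
  shows "\<exists>(X :: (nat \<Rightarrow> nat) topology) (G :: ((nat \<Rightarrow> nat) \<times> (nat \<Rightarrow> nat)) set).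
           Polish_topology X \<and> Borel_graph X G \<and> sym G \<and> fully_looped X G \<and>
           aleph0_regular X G \<and> acyclic_graph G \<and>
           \<not> (\<exists>D :: nat \<Rightarrow> (nat \<Rightarrow> nat) set. Baire_domatic_partition X G 3 D)"
proof (intro exI conjI)
  show "Polish_topology (euclidean :: (nat \<Rightarrow> nat) topology)"
    by (rule Polish_topology_Baire_space)
  show "Borel_graph euclidean flip_graph"
    by (rule Borel_graph_flip_graph)
  show "sym flip_graph"
    by (rule sym_flip_graph)
  show "aleph0_regular euclidean flip_graph"
    by (rule aleph0_regular_flip_graph)
  show "acyclic_graph flip_graph"
    by (rule acyclic_flip_graph)
  show "fully_looped euclidean flip_graph"
    by (simp add: fully_looped_def flip_graph_def)
  show "\<not> (\<exists>D. Baire_domatic_partition euclidean flip_graph 3 D)"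
    by (simp add: no_Baire_domatic_partition_flip_graph)
qed

end
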